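(* Let $\{\theta_n\}_{n\ge 1}$ be any sequence of real numbers. Then: (1) Given any real $\lambda \neq 0$ and any real $A > 1$, there exists a real number $\alpha$ such that $$A \leq \alpha \leq A + \frac{A}{|\lambda|(A-1)}$$ and, for every integer $n \geq 1$, $$\|\lambda \alpha^n - \theta_n\| \leq \frac{1}{2(A-1)}.$$ (2) Given any real $\alpha > 1$ and any real $L \neq 0$, there exists a real number $\lambda$ with the same sign as $L$ such that $$|L| \leq |\lambda| \leq |L| + \frac{1}{\alpha - 1}$$ and, for every integer $n \geq 1$, $$\|\lambda \alpha^n - \theta_n\| \leq \frac{1}{2(\alpha - 1)}.$$
   Context: For a real number $x$, $\|x\| = \min\{|x-n| : n \in \mathbb{Z}\}$ denotes the distance from $x$ to the nearest integer. *)

theory Defs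
  imports Complex_Main
begin

definition dist_int :: "real \<Rightarrow> real" where
  "dist_int x = (INF n::int. \<bar>x - of_int n\<bar>)"

(* The index set is infinite, so the minimum is written as an infimum;
   the next lemma shows that it is attained. *)
lemma dist_int_attained: "\<exists>m::int. dist_int x = \<bar>x - of_int m\<bar> \<and> (\<forall>n::int. dist_int x \<le> \<bar>x - of_int n\<bar>)"
proof -
  have *: "\<bar>x - of_int (round x)\<bar> \<le> \<bar>x - of_int n\<bar>" for n :: int
    using round_diff_minimal[of x n] by simp
  have "dist_int x = \<bar>x - of_int (round x)\<bar>"
    unfolding dist_int_def
    by (rule cInf_eq_minimum) (use * in auto)
  with * show ?thesis by auto
qed

end

theory Submission
  imports Defs
begin

text \<open>
  Both parts are one nested-interval argument. Put \<open>D = 1 / (A - 1)\<close>, so that \<open>A * D = D + 1\<close>;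
  for the second part, read \<open>A = \<alpha>\<close>.
  Suppose a parameter interval is mapped by the \<open>n\<close>-th function onto an interval of length \<open>D\<close>
  centred at a point of \<open>\<theta> n + \<int>\<close>; every parameter in it then meets the \<open>n\<close>-th constraint. The
  next function stretches lengths by a factor of at least \<open>A\<close>, so its image has length at
  least \<open>D + 1\<close>. The admissible centres of subintervals of length \<open>D\<close> therefore fill an interval of
  length at least \<open>1\<close>, which contains a point of \<open>\<theta> (Suc n) + \<int>\<close>, and the construction goes on. A point
  common to all the parameter intervals meets all the constraints.

  The initial parameter interval is taken so long that the first image has length \<open>D + 1\<close>; this is where
  the upper bounds \<open>A + A / (\<bar>l\<bar> * (A - 1))\<close> and \<open>\<bar>L\<bar> + 1 / (\<alpha> - 1)\<close> come from. Since \<open>dist_int\<close> is even,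
  negative \<open>l\<close> and \<open>L\<close> reduce to positive ones by changing the sign of \<open>\<theta>\<close>.
\<close>

lemma dist_int_le_dist: "dist_int x \<le> \<bar>x - of_int n\<bar>"
  using dist_int_attained[of x] by blast

lemma dist_int_minus: "dist_int (- x) = dist_int x"
proof (rule antisym)
  have le: "dist_int (- y) \<le> dist_int y" for y
  proof -
    obtain m :: int where "dist_int y = \<bar>y - of_int m\<bar>"
      using dist_int_attained[of y] by blast
    then show ?thesis
      using dist_int_le_dist[of "- y" "- m"] by simp
  qed
  show "dist_int (- x) \<le> dist_int x"
    by (rule le)
  show "dist_int x \<le> dist_int (- x)"
    using le[of "- x"] by simp
qed

lemma dist_int_sgn_mult: "s \<noteq> 0 \<Longrightarrow> dist_int (sgn s * x) = dist_int x"
  by (cases "s > 0") (auto simp: sgn_if dist_int_minus)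

lemma nested_intervals_common_point:
  fixes u v :: "nat \<Rightarrow> real"
  assumes u: "incseq u" and v: "decseq v" and le: "\<And>n. u n \<le> v n"
  shows "\<exists>x. \<forall>n. u n \<le> x \<and> x \<le> v n"
proof -
  have cross: "u m \<le> v n" for m n
    using incseqD[OF u, of m "max m n"] le[of "max m n"] decseqD[OF v, of n "max m n"] by simp
  have bdd: "bdd_above (range u)"
    using cross[of _ 0] by (auto simp: bdd_above_def)
  show ?thesis
  proof (intro exI[of _ "SUP m. u m"] allI conjI)
    fix n
    show "u n \<le> (SUP m. u m)"
      by (rule cSUP_upper[OF UNIV_I bdd])
    show "(SUP m. u m) \<le> v n"
      by (rule cSUP_least) (use cross in auto)
  qed
qed

text \<open>
  The centre of the image is the least point of \<open>t + \<int>\<close> that lies at least \<open>D / 2\<close> above \<open>g u\<close>. It exceeds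
  \<open>g u + D / 2\<close> by less than \<open>1\<close>, so an image of length \<open>D + 1\<close> leaves room for \<open>D / 2\<close> above it as well.
\<close>

lemma subinterval_near_translated_integer:
  fixes g :: "real \<Rightarrow> real"
  assumes "u \<le> v" and cont: "continuous_on {u..v} g" and mono: "mono_on {u..v} g"
    and "D \<ge> 0" and long: "g v - g u \<ge> D + 1"
  shows "\<exists>u' v'. u \<le> u' \<and> u' \<le> v' \<and> v' \<le> v \<and> g v' - g u' = D
            \<and> (\<forall>x\<in>{u'..v'}. dist_int (g x - t) \<le> D / 2)"
proof -
  define k where "k = \<lceil>g u + D / 2 - t\<rceil>"
  define p where "p = t + of_int k - D / 2"
  have p: "g u \<le> p" "p + D \<le> g v"
    using ceiling_correct[of "g u + D / 2 - t"] long unfolding p_def k_def by linarith+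
  obtain u' where u': "u \<le> u'" "u' \<le> v" "g u' = p"
    using IVT'[of g u p v] p \<open>D \<ge> 0\<close> \<open>u \<le> v\<close> cont by auto
  have "continuous_on {u'..v} g"
    using cont by (rule continuous_on_subset) (use u' in auto)
  then obtain v' where v': "u' \<le> v'" "v' \<le> v" "g v' = p + D"
    using IVT'[of g u' "p + D" v] p \<open>D \<ge> 0\<close> u' by auto
  have "dist_int (g x - t) \<le> D / 2" if x: "x \<in> {u'..v'}" for x
  proof -
    have "g u' \<le> g x" "g x \<le> g v'"
      by (rule mono_onD[OF mono]; use x u' v' in simp)+
    then have "\<bar>g x - t - of_int k\<bar> \<le> D / 2"
      using u'(3) v'(3) unfolding p_def by linarith
    then show ?thesis
      using dist_int_le_dist[of "g x - t" k] by linarith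
  qed
  then show ?thesis
    using u' v' by (intro exI[of _ u'] exI[of _ v']) simp
qed

text \<open>
  The nested-interval construction for a general family of functions, so that it applies both to
  \<open>x \<mapsto> l * x ^ Suc n\<close> and to \<open>x \<mapsto> x * \<alpha> ^ Suc n\<close>. The stretching hypothesis restores, after each
  step, the length \<open>D + 1\<close> that the choice of the next subinterval consumes.
\<close>

lemma exists_near_translated_integers:
  fixes g :: "nat \<Rightarrow> real \<Rightarrow> real" and t :: "nat \<Rightarrow> real"
  assumes "a \<le> b" and "D \<ge> 0"
    and cont: "\<And>n. continuous_on {a..b} (g n)"
    and mono: "\<And>n. mono_on {a..b} (g n)"
    and initial: "g 0 b - g 0 a \<ge> D + 1"
    and stretch: "\<And>n u v. a \<le> u \<Longrightarrow> u \<le> v \<Longrightarrow> v \<le> b \<Longrightarrow> g n v - g n u = D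
                    \<Longrightarrow> g (Suc n) v - g (Suc n) u \<ge> D + 1"
  shows "\<exists>x\<in>{a..b}. \<forall>n. dist_int (g n x - t n) \<le> D / 2"
proof -
  define good where "good n I \<longleftrightarrow> a \<le> fst I \<and> fst I \<le> snd I \<and> snd I \<le> b
      \<and> g n (snd I) - g n (fst I) = D
      \<and> (\<forall>x\<in>{fst I..snd I}. dist_int (g n x - t n) \<le> D / 2)" for n :: nat and I :: "real \<times> real"
  have refine: "\<exists>I. good n I \<and> u \<le> fst I \<and> snd I \<le> v"
    if "a \<le> u" "u \<le> v" "v \<le> b" "g n v - g n u \<ge> D + 1" for n u v
  proof -
    have "{u..v} \<subseteq> {a..b}"
      using that by auto
    then have "continuous_on {u..v} (g n)" "mono_on {u..v} (g n)"
      using cont[of n] mono[of n] continuous_on_subset mono_on_subset by blast+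
    from subinterval_near_translated_integer[OF \<open>u \<le> v\<close> this \<open>D \<ge> 0\<close> that(4), of "t n"]
    obtain u' v' where "u \<le> u'" "u' \<le> v'" "v' \<le> v" "g n v' - g n u' = D"
      "\<forall>x\<in>{u'..v'}. dist_int (g n x - t n) \<le> D / 2"
      by blast
    then show ?thesis
      using that by (intro exI[of _ "(u', v')"]) (auto simp: good_def)
  qed
  have "\<exists>I. \<forall>n. good n (I n) \<and> fst (I n) \<le> fst (I (Suc n)) \<and> snd (I (Suc n)) \<le> snd (I n)"
  proof (rule dependent_nat_choice)
    show "\<exists>I. good 0 I"
      using refine[of a b 0] \<open>a \<le> b\<close> initial by blast
  next
    fix I n
    assume I: "good n I"
    then have "g (Suc n) (snd I) - g (Suc n) (fst I) \<ge> D + 1"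
      by (intro stretch) (auto simp: good_def)
    then show "\<exists>J. good (Suc n) J \<and> fst I \<le> fst J \<and> snd J \<le> snd I"
      using I by (intro refine) (auto simp: good_def)
  qed
  then obtain I where I: "\<And>n. good n (I n)"
    "\<And>n. fst (I n) \<le> fst (I (Suc n))" "\<And>n. snd (I (Suc n)) \<le> snd (I n)"
    by blast
  have "incseq (\<lambda>n. fst (I n))" "decseq (\<lambda>n. snd (I n))"
    using I by (auto intro: incseq_SucI decseq_SucI)
  moreover have "fst (I n) \<le> snd (I n)" for n
    using I(1)[of n] by (simp add: good_def)
  ultimately obtain x where x: "\<And>n. fst (I n) \<le> x \<and> x \<le> snd (I n)"
    using nested_intervals_common_point by meson
  have "x \<in> {a..b}"
    using x[of 0] I(1)[of 0] by (auto simp: good_def)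
  moreover have "dist_int (g n x - t n) \<le> D / 2" for n
    using x[of n] I(1)[of n] by (auto simp: good_def)
  ultimately show ?thesis
    by blast
qed

text \<open>
  The function \<open>x \<mapsto> (x - A) * x ^ n\<close> is nondecreasing for \<open>x \<ge> A \<ge> 0\<close>: passing from \<open>x ^ n\<close> to \<open>x ^ Suc n\<close>
  stretches at least as much as multiplication by \<open>A\<close>.
\<close>

lemma power_diff_stretch:
  fixes A u v :: real
  assumes "0 \<le> A" "A \<le> u" "u \<le> v"
  shows "v ^ Suc n - u ^ Suc n \<ge> A * (v ^ n - u ^ n)"
proof -
  have "(u - A) * u ^ n \<le> (v - A) * v ^ n"
    using assms by (intro mult_mono power_mono) auto
  then show ?thesis
    by (simp add: algebra_simps)
qed

lemma exists_base_near_translated_integers: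
  fixes l A :: real
  assumes l: "l \<noteq> 0" and A: "A > 1"
  shows "\<exists>\<alpha>. A \<le> \<alpha> \<and> \<alpha> \<le> A + A / (\<bar>l\<bar> * (A - 1))
           \<and> (\<forall>n\<ge>1. dist_int (l * \<alpha> ^ n - \<theta> n) \<le> 1 / (2 * (A - 1)))"
proof -
  define D where "D = 1 / (A - 1)"
  define b where "b = A + A / (\<bar>l\<bar> * (A - 1))"
  have D: "D \<ge> 0" "A * D = D + 1"
    using A by (auto simp: D_def field_simps)
  have b: "A \<le> b" "\<bar>l\<bar> * (b - A) = A * D"
    using A l by (auto simp: b_def D_def)
  have "\<exists>\<alpha>\<in>{A..b}. \<forall>n. dist_int (\<bar>l\<bar> * \<alpha> ^ Suc n - sgn l * \<theta> (Suc n)) \<le> D / 2"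
  proof (rule exists_near_translated_integers)
    fix n :: nat
    show "continuous_on {A..b} (\<lambda>x. \<bar>l\<bar> * x ^ Suc n)"
      by (intro continuous_intros)
    show "mono_on {A..b} (\<lambda>x. \<bar>l\<bar> * x ^ Suc n)"
      using A by (intro mono_onI mult_left_mono power_mono) auto
    fix u v :: real
    assume uv: "A \<le> u" "u \<le> v" and "\<bar>l\<bar> * v ^ Suc n - \<bar>l\<bar> * u ^ Suc n = D"
    then have eq: "\<bar>l\<bar> * (v ^ Suc n - u ^ Suc n) = D"
      by (simp add: right_diff_distrib)
    have "\<bar>l\<bar> * (A * (v ^ Suc n - u ^ Suc n)) \<le> \<bar>l\<bar> * (v ^ Suc (Suc n) - u ^ Suc (Suc n))"
      using A uv by (intro mult_left_mono power_diff_stretch) auto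
    also have "\<bar>l\<bar> * (A * (v ^ Suc n - u ^ Suc n)) = A * D"
      using eq by (metis mult.left_commute)
    finally show "\<bar>l\<bar> * v ^ Suc (Suc n) - \<bar>l\<bar> * u ^ Suc (Suc n) \<ge> D + 1"
      using D by (simp add: right_diff_distrib)
  next
    show "\<bar>l\<bar> * b ^ Suc 0 - \<bar>l\<bar> * A ^ Suc 0 \<ge> D + 1"
      using b D by (simp add: right_diff_distrib)
  qed (use b D in auto)
  then obtain \<alpha> where \<alpha>: "A \<le> \<alpha>" "\<alpha> \<le> b"
    and near: "\<And>n. dist_int (\<bar>l\<bar> * \<alpha> ^ Suc n - sgn l * \<theta> (Suc n)) \<le> D / 2"
    by auto
  have "dist_int (l * \<alpha> ^ n - \<theta> n) \<le> 1 / (2 * (A - 1))" if "n \<ge> 1" for n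
  proof -
    have "sgn l * (l * \<alpha> ^ n - \<theta> n) = \<bar>l\<bar> * \<alpha> ^ n - sgn l * \<theta> n"
      by (simp add: right_diff_distrib abs_sgn mult_ac)
    then have "dist_int (l * \<alpha> ^ n - \<theta> n) = dist_int (\<bar>l\<bar> * \<alpha> ^ n - sgn l * \<theta> n)"
      using dist_int_sgn_mult[OF l, of "l * \<alpha> ^ n - \<theta> n"] by simp
    then show ?thesis
      using near[of "n - 1"] that by (simp add: D_def mult.commute)
  qed
  then show ?thesis
    using \<alpha> unfolding b_def by blast
qed

lemma exists_factor_near_translated_integers:
  fixes \<alpha> L :: real
  assumes \<alpha>: "\<alpha> > 1" and L: "L \<noteq> 0"
  shows "\<exists>l. sgn l = sgn L \<and> \<bar>L\<bar> \<le> \<bar>l\<bar> \<and> \<bar>l\<bar> \<le> \<bar>L\<bar> + 1 / (\<alpha> - 1)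
           \<and> (\<forall>n\<ge>1. dist_int (l * \<alpha> ^ n - \<theta> n) \<le> 1 / (2 * (\<alpha> - 1)))"
proof -
  define D where "D = 1 / (\<alpha> - 1)"
  have D: "D \<ge> 0" "\<alpha> * D = D + 1"
    using \<alpha> by (auto simp: D_def field_simps)
  have "\<exists>m\<in>{\<bar>L\<bar>..\<bar>L\<bar> + D}. \<forall>n. dist_int (m * \<alpha> ^ Suc n - sgn L * \<theta> (Suc n)) \<le> D / 2"
  proof (rule exists_near_translated_integers)
    fix n :: nat
    show "continuous_on {\<bar>L\<bar>..\<bar>L\<bar> + D} (\<lambda>x. x * \<alpha> ^ Suc n)"
      by (intro continuous_intros)
    show "mono_on {\<bar>L\<bar>..\<bar>L\<bar> + D} (\<lambda>x. x * \<alpha> ^ Suc n)"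
      using \<alpha> by (intro mono_onI mult_right_mono) auto
    fix u v :: real
    assume "v * \<alpha> ^ Suc n - u * \<alpha> ^ Suc n = D"
    then have "\<alpha> * (v * \<alpha> ^ Suc n - u * \<alpha> ^ Suc n) = D + 1"
      using D by simp
    then show "v * \<alpha> ^ Suc (Suc n) - u * \<alpha> ^ Suc (Suc n) \<ge> D + 1"
      by (simp add: algebra_simps)
  next
    show "(\<bar>L\<bar> + D) * \<alpha> ^ Suc 0 - \<bar>L\<bar> * \<alpha> ^ Suc 0 \<ge> D + 1"
      using D by (simp add: algebra_simps)
  qed (use D in auto)
  then obtain m where m: "\<bar>L\<bar> \<le> m" "m \<le> \<bar>L\<bar> + D"
    and near: "\<And>n. dist_int (m * \<alpha> ^ Suc n - sgn L * \<theta> (Suc n)) \<le> D / 2"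
    by auto
  define l where "l = sgn L * m"
  have "m > 0"
    using m L by linarith
  then have l: "sgn l = sgn L" "\<bar>l\<bar> = m"
    using L by (auto simp: l_def sgn_mult abs_mult abs_sgn_eq)
  have "dist_int (l * \<alpha> ^ n - \<theta> n) \<le> 1 / (2 * (\<alpha> - 1))" if "n \<ge> 1" for n
  proof -
    have "sgn L * (l * \<alpha> ^ n - \<theta> n) = m * \<alpha> ^ n - sgn L * \<theta> n"
      using L by (auto simp: l_def sgn_if)
    then have "dist_int (l * \<alpha> ^ n - \<theta> n) = dist_int (m * \<alpha> ^ n - sgn L * \<theta> n)"
      using dist_int_sgn_mult[OF L, of "l * \<alpha> ^ n - \<theta> n"] by simp
    then show ?thesis
      using near[of "n - 1"] that by (simp add: D_def mult.commute)
  qed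
  then show ?thesis
    using l m unfolding D_def by blast
qed

theorem theorem3p5:
  fixes \<theta> :: "nat \<Rightarrow> real"
  shows "(\<forall>l A :: real. l \<noteq> 0 \<and> A > 1 \<longrightarrow>
            (\<exists>\<alpha>::real. A \<le> \<alpha> \<and> \<alpha> \<le> A + A / (\<bar>l\<bar> * (A - 1)) \<and>
               (\<forall>n::nat. n \<ge> 1 \<longrightarrow> dist_int (l * \<alpha> ^ n - \<theta> n) \<le> 1 / (2 * (A - 1)))))
       \<and> (\<forall>\<alpha> L :: real. \<alpha> > 1 \<and> L \<noteq> 0 \<longrightarrow>
            (\<exists>l::real. sgn l = sgn L \<and> \<bar>L\<bar> \<le> \<bar>l\<bar> \<and> \<bar>l\<bar> \<le> \<bar>L\<bar> + 1 / (\<alpha> - 1) \<and>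
               (\<forall>n::nat. n \<ge> 1 \<longrightarrow> dist_int (l * \<alpha> ^ n - \<theta> n) \<le> 1 / (2 * (\<alpha> - 1)))))"
  using exists_base_near_translated_integers exists_factor_near_translated_integers by blast

end
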